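(* For every $p\in(1,\infty)$ there exists a number $C_p>1$ such that $$N_p^{\mathrm{disc},+}(\varepsilon,d)\ge C_p^d\,(1-2\varepsilon)\qquad\text{for all } d\in\mathbb{N}\text{ and }\varepsilon\in[0,\tfrac12).$$ In other words, the extreme $L_p$ discrepancy for non-negative weights (and hence also for quasi-Monte Carlo weights $c_1=\cdots=c_N=1/N$) suffers from the curse of dimensionality.
   Context: $\mathbb{N}=\{1,2,\ldots\}$. Let $\mathbb{D}_d:=\{(\boldsymbol{a},\boldsymbol{b})\in[0,1]^d\times[0,1]^d:\ a_j\le b_j \text{ for all } j\}$, equipped with $2d$-dimensional Lebesgue measure, and $[\boldsymbol a,\boldsymbol b)=\prod_{j=1}^d[a_j,b_j)$ with indicator function $\mathbf{1}_{[\boldsymbol a,\boldsymbol b)}$. For points $\mathcal{P}=\{\boldsymbol{x}_1,\ldots,\boldsymbol{x}_N\}\subset[0,1)^d$ and real weights $\mathcal{A}=\{c_1,\ldots,c_N\}$, the generalized extreme $L_p$ discrepancy ($1\le p<\infty$) is $$L_{p,N}^{\mathrm{ext}}(\mathcal{P},\mathcal{A})=\left(\int_{\mathbb{D}_d}\Big|\sum_{k=1}^N c_k\,\mathbf{1}_{[\boldsymbol a,\boldsymbol b)}(\boldsymbol x_k)-\prod_{j=1}^d(b_j-a_j)\Big|^p\,\mathrm{d}(\boldsymbol a,\boldsymbol b)\right)^{1/p}.$$ The initial discrepancy (no points) is $L_{p,0}^{\mathrm{ext}}=\left(\int_{\mathbb{D}_d}\prod_{j=1}^d(b_j-a_j)^p\,\mathrm{d}(\boldsymbol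 a,\boldsymbol b)\right)^{1/p}=((p+1)(p+2))^{-d/p}$. Let $\mathrm{disc}_p^{\mathrm{ext},+}(N,d)$ be the minimum (read as an infimum) of $L_{p,N}^{\mathrm{ext}}(\mathcal{P},\mathcal{A}^+)$ over all $N$-element point sets $\mathcal{P}\subset[0,1)^d$ and all non-negative weights $\mathcal{A}^+=\{c_1,\ldots,c_N\}$, $c_k\ge0$; let $\mathrm{disc}_p^{\mathrm{ext},\mathrm{QMC}}(N,d)$ be the same with the weights fixed to $c_1=\cdots=c_N=1/N$. For $\bullet\in\{+,\mathrm{QMC}\}$ put $$N_p^{\mathrm{disc},\bullet}(\varepsilon,d):=\min\{N\in\mathbb{N}:\ \mathrm{disc}_p^{\mathrm{ext},\bullet}(N,d)\le\varepsilon\,L_{p,0}^{\mathrm{ext}}\},$$ with the convention $\min\emptyset=\infty$. The curse of dimensionality means that this inverse grows at least exponentially in $d$, for fixed $\varepsilon$: here, in the sense of a lower bound of the displayed form with $C_p>1$. *)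

theory Defs
  imports "HOL-Analysis.Analysis"
begin

text \<open>
  Since the dimension \<open>d\<close> is quantified inside the theorem, a vector of \<open>\<real>\<^sup>d\<close> is an extensional function
  on \<open>{..<d}\<close>, i.e. an element of the space of the product measure below.
\<close>

type_synonym rvec = "nat \<Rightarrow> real"

definition lborel_dim :: "nat \<Rightarrow> rvec measure" where
  "lborel_dim d = Pi\<^sub>M {..<d} (\<lambda>_. lborel)"

definition ext_domain :: "nat \<Rightarrow> (rvec \<times> rvec) set" where
  "ext_domain d = {(a, b). a \<in> {..<d} \<rightarrow>\<^sub>E {0..1} \<and> b \<in> {..<d} \<rightarrow>\<^sub>E {0..1} \<and> (\<forall>j<d. a j \<le> b j)}"

definition half_open_box :: "nat \<Rightarrow> rvec \<Rightarrow> rvec \<Rightarrow> rvec set" where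
  "half_open_box d a b = (\<Pi>\<^sub>E j\<in>{..<d}. {a j..<b j})"

text \<open>
  The weights are a function on the points, so \<open>c x\<close> is the weight of the point \<open>x \<in> P\<close>. The integrand
  is bounded and measurable on \<open>ext_domain d\<close>, so the Bochner integral is the genuine one.
\<close>

definition ext_discrepancy :: "real \<Rightarrow> nat \<Rightarrow> rvec set \<Rightarrow> (rvec \<Rightarrow> real) \<Rightarrow> real" where
  "ext_discrepancy p d P c =
     (LINT (a, b) : ext_domain d | lborel_dim d \<Otimes>\<^sub>M lborel_dim d.
        \<bar>(\<Sum>x\<in>P. c x * indicator (half_open_box d a b) x) - (\<Prod>j<d. b j - a j)\<bar> powr p) powr (1 / p)"

definition ext_initial_discrepancy :: "real \<Rightarrow> nat \<Rightarrow> real" where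
  "ext_initial_discrepancy p d =
     (LINT (a, b) : ext_domain d | lborel_dim d \<Otimes>\<^sub>M lborel_dim d.
        (\<Prod>j<d. (b j - a j) powr p)) powr (1 / p)"

definition point_sets :: "nat \<Rightarrow> nat \<Rightarrow> rvec set set" where
  "point_sets N d = {P. P \<subseteq> ({..<d} \<rightarrow>\<^sub>E {0..<1}) \<and> finite P \<and> card P = N}"

definition disc_ext_plus :: "real \<Rightarrow> nat \<Rightarrow> nat \<Rightarrow> real" where
  "disc_ext_plus p N d =
     Inf {ext_discrepancy p d P c | P c. P \<in> point_sets N d \<and> (\<forall>x\<in>P. 0 \<le> c x)}"

definition disc_ext_QMC :: "real \<Rightarrow> nat \<Rightarrow> nat \<Rightarrow> real" where
  "disc_ext_QMC p N d =
     Inf {ext_discrepancy p d P (\<lambda>_. 1 / real N) | P. P \<in> point_sets N d}"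

text \<open>The infimum in \<^typ>\<open>enat\<close> is attained on nonempty sets, and is \<open>\<infinity>\<close> on the empty set.\<close>

definition N_disc_plus :: "real \<Rightarrow> real \<Rightarrow> nat \<Rightarrow> enat" where
  "N_disc_plus p \<epsilon> d =
     Inf (enat ` {N. 1 \<le> N \<and> disc_ext_plus p N d \<le> \<epsilon> * ext_initial_discrepancy p d})"

definition N_disc_QMC :: "real \<Rightarrow> real \<Rightarrow> nat \<Rightarrow> enat" where
  "N_disc_QMC p \<epsilon> d =
     Inf (enat ` {N. 1 \<le> N \<and> disc_ext_QMC p N d \<le> \<epsilon> * ext_initial_discrepancy p d})"

end

theory Submission
  imports Defs
begin

text \<open>
  A box that contains none of the points of \<open>P\<close> receives no weight, so there the local discrepancy
  is minus the volume \<open>V\<close> of the box, exactly as for the initial discrepancy. To beat the initial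
  discrepancy, the points must therefore meet boxes that carry a substantial part of the moment
  \<open>\<integral> V\<^sup>p\<close>, and a single point can only meet boxes that carry an exponentially small part of it.

  In detail, the pointwise bound
  \<open>V\<^sup>p \<le> \<bar>local discrepancy\<bar>\<^sup>p + (\<Sum>x\<in>P. V\<^sup>p \<cdot> [x \<in> box])\<close> holds, and both \<open>\<integral> V\<^sup>p\<close> and
  \<open>\<integral> V\<^sup>p \<cdot> [x \<in> box]\<close> are products of \<open>d\<close> integrals over intervals. In dimension one, an interval
  avoids a given \<open>x \<in> [0,1)\<close> as soon as it lies in the half of \<open>[0,1]\<close> on the other side of \<open>x\<close>; hence
  intervals through \<open>x\<close> carry at most the fraction \<open>r = 1 - (1/4)\<^sup>p / 64 < 1\<close> of the moment,
  uniformly in \<open>x\<close> (\<open>length_moment_containing_le\<close>). Integrating gives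
  \<open>(1 - N r\<^sup>d) (initial discrepancy)\<^sup>p \<le> discrepancy\<^sup>p\<close> for every weighted \<open>N\<close>-point set
  (\<open>ext_discrepancy_lower_bound\<close>).
  A discrepancy of at most \<open>\<epsilon>\<close> times the initial one thus forces
  \<open>N r\<^sup>d \<ge> 1 - \<epsilon>\<^sup>p \<ge> 1 - \<epsilon> \<ge> 1 - 2\<epsilon>\<close>, and \<open>C = 1/r\<close> works.
\<close>

section \<open>Product integrals over pairs of vectors\<close>

lemma component_measurable:
  "j < d \<Longrightarrow> (\<lambda>w. w j) \<in> borel_measurable (lborel_dim d)"
  unfolding lborel_dim_def using measurable_component_singleton[of j "{..<d}" "\<lambda>_. lborel"] by simp

lemma endpoint_measurable:
  assumes "j < d"
  shows "(\<lambda>w. fst w j) \<in> borel_measurable (lborel_dim d \<Otimes>\<^sub>M lborel_dim d)"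
    "(\<lambda>w. snd w j) \<in> borel_measurable (lborel_dim d \<Otimes>\<^sub>M lborel_dim d)"
  using component_measurable[OF assms]
  by (auto intro: measurable_compose[OF measurable_fst] measurable_compose[OF measurable_snd])

text \<open>
  Tonelli separates \<open>a\<close> from \<open>b\<close>, after which the coordinates of \<open>b\<close> and then those of \<open>a\<close>
  factor out of the two product integrals.
\<close>

lemma nn_integral_lborel_dim_pair_prod:
  fixes f :: "nat \<Rightarrow> real \<times> real \<Rightarrow> ennreal"
  assumes f: "\<And>j. j < d \<Longrightarrow> f j \<in> borel_measurable (lborel \<Otimes>\<^sub>M lborel)"
  shows "(\<integral>\<^sup>+ w. (\<Prod>j<d. f j (fst w j, snd w j)) \<partial>(lborel_dim d \<Otimes>\<^sub>M lborel_dim d)) =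
         (\<Prod>j<d. \<integral>\<^sup>+ z. f j z \<partial>(lborel \<Otimes>\<^sub>M lborel))"
proof -
  interpret product_sigma_finite "\<lambda>_::nat. lborel :: real measure" ..
  interpret L: sigma_finite_measure "lborel_dim d"
    unfolding lborel_dim_def by (rule sigma_finite) simp
  have m: "(\<lambda>w. f j (fst w j, snd w j)) \<in> borel_measurable (lborel_dim d \<Otimes>\<^sub>M lborel_dim d)"
    if "j < d" for j
    using endpoint_measurable[OF that]
    by (auto intro!: measurable_compose[OF _ f[OF that]] measurable_Pair)
  have fs: "(\<lambda>b. f j (a, b)) \<in> borel_measurable lborel" if "j < d" for j a
    using f[OF that] by (rule measurable_Pair2) simp
  have "(\<integral>\<^sup>+ w. (\<Prod>j<d. f j (fst w j, snd w j)) \<partial>(lborel_dim d \<Otimes>\<^sub>M lborel_dim d)) =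
      (\<integral>\<^sup>+ a. \<integral>\<^sup>+ b. (\<Prod>j<d. f j (a j, b j)) \<partial>lborel_dim d \<partial>lborel_dim d)"
    using m by (subst L.nn_integral_fst[symmetric]) auto
  also have "\<dots> = (\<integral>\<^sup>+ a. (\<Prod>j<d. \<integral>\<^sup>+ t. f j (a j, t) \<partial>lborel) \<partial>lborel_dim d)"
    unfolding lborel_dim_def using fs by (subst product_nn_integral_prod) auto
  also have "\<dots> = (\<Prod>j<d. \<integral>\<^sup>+ s. \<integral>\<^sup>+ t. f j (s, t) \<partial>lborel \<partial>lborel)"
    unfolding lborel_dim_def using f
    by (subst product_nn_integral_prod) (auto intro!: lborel.borel_measurable_nn_integral_fst)
  also have "\<dots> = (\<Prod>j<d. \<integral>\<^sup>+ z. f j z \<partial>(lborel \<Otimes>\<^sub>M lborel))"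
    using f by (intro prod.cong lborel.nn_integral_fst) auto
  finally show ?thesis .
qed

section \<open>The moment of the intervals through a point\<close>

definition unit_intervals :: "(real \<times> real) set" where
  "unit_intervals = {(a, b). 0 \<le> a \<and> a \<le> b \<and> b \<le> 1}"

definition length_moment :: "real \<Rightarrow> (real \<times> real) set \<Rightarrow> ennreal" where
  "length_moment p S =
     (\<integral>\<^sup>+ z. ennreal ((snd z - fst z) powr p) * indicator (unit_intervals \<inter> S) z \<partial>(lborel \<Otimes>\<^sub>M lborel))"

text \<open>
  A lower bound, uniform in \<open>x\<close>, for the moment of the intervals that avoid \<open>x\<close>: the intervals with
  left endpoint in the first quarter and right endpoint in the last quarter of one half of \<open>[0,1]\<close>
  have length at least \<open>1/4\<close> and form a square of area \<open>1/64\<close>.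
\<close>

definition escape_mass :: "real \<Rightarrow> real" where
  "escape_mass p = (1/4) powr p / 64"

lemma escape_mass_bounds: "0 \<le> p \<Longrightarrow> 0 < escape_mass p \<and> escape_mass p < 1"
  using powr_le1[of p "1/4"] by (auto simp: escape_mass_def)

lemma unit_intervals_measurable [measurable]: "unit_intervals \<in> sets (lborel \<Otimes>\<^sub>M lborel)"
proof -
  have "unit_intervals = {z \<in> space (lborel \<Otimes>\<^sub>M lborel). 0 \<le> fst z \<and> fst z \<le> snd z \<and> snd z \<le> 1}"
    by (auto simp: unit_intervals_def space_pair_measure)
  also have "\<dots> \<in> sets (lborel \<Otimes>\<^sub>M lborel)" by measurable
  finally show ?thesis .
qed

lemma intervals_containing_measurable [measurable]:
  "{(a, b). a \<le> x \<and> x < b} \<in> sets (lborel \<Otimes>\<^sub>M lborel)" for x :: real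
proof -
  have "{(a, b). a \<le> x \<and> x < b} = {z \<in> space (lborel \<Otimes>\<^sub>M lborel). fst z \<le> x \<and> x < snd z}"
    by (auto simp: space_pair_measure)
  also have "\<dots> \<in> sets (lborel \<Otimes>\<^sub>M lborel)" by measurable
  finally show ?thesis .
qed

lemma length_moment_UNIV_le_1:
  assumes "0 \<le> p" shows "length_moment p UNIV \<le> 1"
proof -
  have "length_moment p UNIV \<le> (\<integral>\<^sup>+ z. indicator ({0..1::real} \<times> {0..1::real}) z \<partial>(lborel \<Otimes>\<^sub>M lborel))"
    unfolding length_moment_def using assms
    by (intro nn_integral_mono)
       (auto simp: unit_intervals_def powr_le1 split: split_indicator)
  also have "\<dots> = 1"
    by (simp add: lborel.emeasure_pair_measure_Times)
  finally show ?thesis .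
qed

lemma length_moment_containing_plus_escape_mass_le:
  assumes p: "0 \<le> p"
  shows "length_moment p {(a, b). a \<le> x \<and> x < b} + ennreal (escape_mass p) \<le> length_moment p UNIV"
proof -
  let ?f = "\<lambda>z::real \<times> real. ennreal ((snd z - fst z) powr p)"
  let ?L = "lborel \<Otimes>\<^sub>M lborel :: (real \<times> real) measure"
  let ?S = "{(a, b). a \<le> x \<and> x < b}"
  (* [l, l + 1/2] is a half of [0,1] such that no half-open interval in it contains x. *)
  define l where "l = (if x < 1/2 then 1/2 else 0 :: real)"
  define R where "R = {l..l + 1/8} \<times> {l + 3/8..l + 1/2}"
  have RL: "R \<in> sets ?L" by (simp add: R_def)
  have R: "R \<subseteq> unit_intervals - ?S"
    by (auto simp: R_def l_def unit_intervals_def split: if_splits)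
  have len: "(1/4) powr p \<le> (snd z - fst z) powr p" if "z \<in> R" for z
    using that p by (intro powr_mono2) (auto simp: R_def)
  have "ennreal (escape_mass p) = (\<integral>\<^sup>+ z. ennreal ((1/4) powr p) * indicator R z \<partial>?L)"
    using RL by (simp add: nn_integral_cmult_indicator R_def lborel.emeasure_pair_measure_Times
        escape_mass_def flip: ennreal_mult)
  also have "\<dots> \<le> (\<integral>\<^sup>+ z. ?f z * indicator R z \<partial>?L)"
    using len by (intro nn_integral_mono) (auto split: split_indicator intro!: ennreal_leI)
  finally have "length_moment p ?S + ennreal (escape_mass p) \<le>
      length_moment p ?S + (\<integral>\<^sup>+ z. ?f z * indicator R z \<partial>?L)"
    by (rule add_left_mono)
  also have "\<dots> = (\<integral>\<^sup>+ z. ?f z * indicator (unit_intervals \<inter> ?S) z + ?f z * indicator R z \<partial>?L)"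
    unfolding length_moment_def using RL by (subst nn_integral_add) auto
  also have "\<dots> \<le> length_moment p UNIV"
    unfolding length_moment_def using R
    by (intro nn_integral_mono) (auto split: split_indicator)
  finally show ?thesis .
qed

text \<open>
  Because the total moment is at most \<open>1\<close>, the additive gap \<open>escape_mass p\<close> is also a relative one.
  Only the relative form survives taking products over the coordinates.
\<close>

lemma length_moment_containing_le:
  assumes p: "0 \<le> p"
  shows "length_moment p {(a, b). a \<le> x \<and> x < b} \<le>
         ennreal (1 - escape_mass p) * length_moment p UNIV"
proof -
  let ?J = "length_moment p {(a, b). a \<le> x \<and> x < b}" and ?I = "length_moment p UNIV"
  note le = length_moment_containing_plus_escape_mass_le[OF p, of x]
    and le1 = length_moment_UNIV_le_1[OF p] and e = escape_mass_bounds[OF p]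
  obtain i where i: "?I = ennreal i" "0 \<le> i"
    using le1 by (cases ?I) (auto simp: top_unique)
  obtain j where j: "?J = ennreal j" "0 \<le> j"
    using le le1 by (cases ?J) (auto simp: top_unique)
  have "j + escape_mass p \<le> i"
    using le i j e by (simp flip: ennreal_plus)
  moreover have "escape_mass p * i \<le> escape_mass p"
    using le1 i e by (simp add: mult_left_le)
  ultimately have "j \<le> (1 - escape_mass p) * i"
    by (simp add: algebra_simps)
  then show ?thesis
    using i j e by (simp add: ennreal_leI flip: ennreal_mult)
qed

lemma length_moment_UNIV_pos:
  assumes "0 \<le> p" shows "0 < length_moment p UNIV"
proof -
  have "0 < ennreal (escape_mass p)"
    using escape_mass_bounds[OF assms] by simp
  also have "\<dots> \<le> length_moment p UNIV"
    using length_moment_containing_plus_escape_mass_le[OF assms, of 0]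
    by (rule order_trans[rotated]) simp
  finally show ?thesis .
qed

section \<open>Moments of the volume of boxes\<close>

lemma ext_domain_iff:
  assumes "w \<in> space (lborel_dim d \<Otimes>\<^sub>M lborel_dim d)"
  shows "w \<in> ext_domain d \<longleftrightarrow> (\<forall>j<d. (fst w j, snd w j) \<in> unit_intervals)"
  using assms unfolding ext_domain_def unit_intervals_def lborel_dim_def
  by (cases w) (force simp: space_pair_measure space_PiM PiE_iff)

lemma ext_domain_measurable [measurable]:
  "ext_domain d \<in> sets (lborel_dim d \<Otimes>\<^sub>M lborel_dim d)"
proof -
  let ?M = "lborel_dim d \<Otimes>\<^sub>M lborel_dim d"
  have "ext_domain d \<subseteq> space ?M"
    by (auto simp: ext_domain_def lborel_dim_def space_pair_measure space_PiM)
  then have "ext_domain d = {w \<in> space ?M. \<forall>j\<in>{..<d}. 0 \<le> fst w j \<and> fst w j \<le> snd w j \<and> snd w j \<le> 1}"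
    using ext_domain_iff[of _ d] by (auto simp: unit_intervals_def)
  also have "\<dots> \<in> sets ?M"
    using endpoint_measurable[of _ d]
    by (intro sets.sets_Collect_finite_All sets.sets_Collect_conj borel_measurable_le) auto
  finally show ?thesis .
qed

lemma box_volume_measurable [measurable]:
  "(\<lambda>w. \<Prod>j<d. snd w j - fst w j) \<in> borel_measurable (lborel_dim d \<Otimes>\<^sub>M lborel_dim d)"
  using endpoint_measurable[of _ d] by (intro borel_measurable_prod borel_measurable_diff) auto

lemma boxes_containing_measurable:
  assumes "x \<in> extensional {..<d}"
  shows "(\<lambda>w. indicator (half_open_box d (fst w) (snd w)) x :: real)
    \<in> borel_measurable (lborel_dim d \<Otimes>\<^sub>M lborel_dim d)"
proof -
  let ?M = "lborel_dim d \<Otimes>\<^sub>M lborel_dim d"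
  have "{w \<in> space ?M. \<forall>j\<in>{..<d}. fst w j \<le> x j \<and> x j < snd w j} \<in> sets ?M" (is "?B \<in> _")
    using endpoint_measurable[of _ d]
    by (intro sets.sets_Collect_finite_All sets.sets_Collect_conj borel_measurable_le
        borel_measurable_less) auto
  then have "(indicator ?B :: _ \<Rightarrow> real) \<in> borel_measurable ?M" by simp
  moreover have "indicator (half_open_box d (fst w) (snd w)) x = (indicator ?B w :: real)"
    if "w \<in> space ?M" for w
    using that assms by (auto simp: half_open_box_def PiE_iff split: split_indicator)
  ultimately show ?thesis
    by (subst measurable_cong) auto
qed

text \<open>
  A condition on boxes that is imposed coordinate by coordinate makes the moment of the volume
  factorise. It is applied to all boxes and to the boxes through a fixed point.
\<close>

lemma nn_integral_box_moment:
  fixes S :: "nat \<Rightarrow> (real \<times> real) set"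
  assumes S: "\<And>j. j < d \<Longrightarrow> S j \<in> sets (lborel \<Otimes>\<^sub>M lborel)"
    and B: "\<And>w. w \<in> space (lborel_dim d \<Otimes>\<^sub>M lborel_dim d) \<Longrightarrow>
      w \<in> B \<longleftrightarrow> (\<forall>j<d. (fst w j, snd w j) \<in> S j)"
  shows "(\<integral>\<^sup>+ w. ennreal ((\<Prod>j<d. snd w j - fst w j) powr p) * indicator (ext_domain d \<inter> B) w
      \<partial>(lborel_dim d \<Otimes>\<^sub>M lborel_dim d)) = (\<Prod>j<d. length_moment p (S j))"
proof -
  let ?M = "lborel_dim d \<Otimes>\<^sub>M lborel_dim d"
  let ?f = "\<lambda>j z. ennreal ((snd z - fst z) powr p) * indicator (unit_intervals \<inter> S j) z"
  have "ennreal ((\<Prod>j<d. snd w j - fst w j) powr p) * indicator (ext_domain d \<inter> B) w =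
      (\<Prod>j<d. ?f j (fst w j, snd w j))" if w: "w \<in> space ?M" for w
  proof (cases "w \<in> ext_domain d \<inter> B")
    case True
    then have *: "\<And>j. j < d \<Longrightarrow> (fst w j, snd w j) \<in> unit_intervals \<inter> S j"
      using ext_domain_iff[OF w] B[OF w] by auto
    then have "\<And>j. j < d \<Longrightarrow> fst w j \<le> snd w j"
      by (auto simp: unit_intervals_def)
    then show ?thesis
      using True * by (simp add: prod_ennreal prod_powr_distrib)
  next
    case False
    then obtain j where "j < d" "(fst w j, snd w j) \<notin> unit_intervals \<inter> S j"
      using ext_domain_iff[OF w] B[OF w] by auto
    then have "\<exists>j\<in>{..<d}. ?f j (fst w j, snd w j) = 0"
      by (intro bexI[of _ j]) auto
    then have "(\<Prod>j<d. ?f j (fst w j, snd w j)) = 0"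
      by (intro prod_zero) auto
    then show ?thesis using False by simp
  qed
  then show ?thesis
    unfolding length_moment_def using S
    by (subst nn_integral_lborel_dim_pair_prod[symmetric]) (auto intro!: nn_integral_cong)
qed

lemma nn_integral_initial:
  "(\<integral>\<^sup>+ w. ennreal ((\<Prod>j<d. snd w j - fst w j) powr p) * indicator (ext_domain d) w
      \<partial>(lborel_dim d \<Otimes>\<^sub>M lborel_dim d)) = length_moment p UNIV ^ d"
  using nn_integral_box_moment[of d "\<lambda>_. UNIV" UNIV p] sets.top[of "lborel \<Otimes>\<^sub>M lborel :: (real \<times> real) measure"]
  by (simp add: space_pair_measure)

lemma nn_integral_boxes_containing_le:
  assumes p: "0 \<le> p" and x: "x \<in> extensional {..<d}"
  shows "(\<integral>\<^sup>+ w. ennreal ((\<Prod>j<d. snd w j - fst w j) powr p) *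
        indicator (ext_domain d \<inter> {w. x \<in> half_open_box d (fst w) (snd w)}) w
      \<partial>(lborel_dim d \<Otimes>\<^sub>M lborel_dim d)) \<le>
    ennreal ((1 - escape_mass p) ^ d) * length_moment p UNIV ^ d"
proof -
  have "(\<integral>\<^sup>+ w. ennreal ((\<Prod>j<d. snd w j - fst w j) powr p) *
        indicator (ext_domain d \<inter> {w. x \<in> half_open_box d (fst w) (snd w)}) w
      \<partial>(lborel_dim d \<Otimes>\<^sub>M lborel_dim d)) =
    (\<Prod>j<d. length_moment p {(a, b). a \<le> x j \<and> x j < b})"
    using x by (intro nn_integral_box_moment) (auto simp: half_open_box_def PiE_iff)
  also have "\<dots> \<le> (\<Prod>j<d. ennreal (1 - escape_mass p) * length_moment p UNIV)"
    using length_moment_containing_le[OF p] by (intro prod_mono_ennreal) auto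
  also have "\<dots> = ennreal ((1 - escape_mass p) ^ d) * length_moment p UNIV ^ d"
    using escape_mass_bounds[OF p] by (simp add: power_mult_distrib ennreal_power)
  finally show ?thesis .
qed

section \<open>Lower bounds for the discrepancy\<close>

lemma ext_initial_discrepancy_powr:
  assumes p: "0 < p"
  shows "ennreal (ext_initial_discrepancy p d powr p) = length_moment p UNIV ^ d"
    and "0 < ext_initial_discrepancy p d"
proof -
  let ?M = "lborel_dim d \<Otimes>\<^sub>M lborel_dim d"
  let ?g = "\<lambda>w. (\<Prod>j<d. snd w j - fst w j) powr p * indicator (ext_domain d) w"
  let ?i = "LINT (a, b) : ext_domain d | ?M. (\<Prod>j<d. (b j - a j) powr p)"
  have "?i = integral\<^sup>L ?M ?g"
    unfolding set_lebesgue_integral_def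
    by (intro Bochner_Integration.integral_cong)
       (auto simp: ext_domain_def prod_powr_distrib split: split_indicator)
  also have "\<dots> = enn2real (\<integral>\<^sup>+ w. ennreal (?g w) \<partial>?M)"
    by (intro integral_eq_nn_integral) auto
  also have "\<dots> = enn2real (length_moment p UNIV ^ d)"
    by (simp add: ennreal_mult ennreal_indicator nn_integral_initial)
  finally have i: "?i = enn2real (length_moment p UNIV ^ d)" .
  have "length_moment p UNIV < top"
    using length_moment_UNIV_le_1[of p] p by (simp add: order_le_less_trans)
  then have fin: "length_moment p UNIV ^ d < top"
    by (simp add: power_less_top_ennreal)
  have pos: "0 < length_moment p UNIV ^ d"
    using length_moment_UNIV_pos[of p] p by (induction d) (auto simp: ennreal_zero_less_mult_iff)
  have ipos: "0 < ?i"
    unfolding i using fin pos by (simp add: enn2real_positive_iff)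
  show "0 < ext_initial_discrepancy p d"
    unfolding ext_initial_discrepancy_def using ipos by simp
  have "ext_initial_discrepancy p d powr p = ?i"
    unfolding ext_initial_discrepancy_def using ipos p by (simp add: powr_powr)
  then show "ennreal (ext_initial_discrepancy p d powr p) = length_moment p UNIV ^ d"
    using i fin by simp
qed

text \<open>
  The local discrepancy is bounded by \<open>(\<Sum>x\<in>P. \<bar>c x\<bar>) + 1\<close> on a domain of finite measure, so the
  Bochner integral in the definition is finite and can be replaced by a nonnegative integral.
\<close>

lemma ext_discrepancy_powr:
  assumes p: "0 < p" and fin: "finite P" and P: "P \<subseteq> extensional {..<d}"
  shows "ennreal (ext_discrepancy p d P c powr p) =
    (\<integral>\<^sup>+ w. ennreal (\<bar>(\<Sum>x\<in>P. c x * indicator (half_open_box d (fst w) (snd w)) x) -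
        (\<Prod>j<d. snd w j - fst w j)\<bar> powr p) * indicator (ext_domain d) w
      \<partial>(lborel_dim d \<Otimes>\<^sub>M lborel_dim d))"
proof -
  let ?M = "lborel_dim d \<Otimes>\<^sub>M lborel_dim d"
  let ?h = "\<lambda>w. \<bar>(\<Sum>x\<in>P. c x * indicator (half_open_box d (fst w) (snd w)) x) -
        (\<Prod>j<d. snd w j - fst w j)\<bar>"
  let ?g = "\<lambda>w. ?h w powr p * indicator (ext_domain d) w"
  let ?K = "(\<Sum>x\<in>P. \<bar>c x\<bar>) + 1"
  have [measurable]: "?g \<in> borel_measurable ?M"
    using boxes_containing_measurable P fin by (measurable; auto)
  have "?h w powr p \<le> ?K powr p" if "w \<in> ext_domain d" for w
  proof (intro powr_mono2)
    have "\<bar>\<Sum>x\<in>P. c x * indicator (half_open_box d (fst w) (snd w)) x\<bar> \<le> (\<Sum>x\<in>P. \<bar>c x\<bar>)"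
      by (intro order_trans[OF sum_abs] sum_mono) (auto split: split_indicator)
    moreover have "0 \<le> snd w j - fst w j \<and> snd w j - fst w j \<le> 1" if "j < d" for j
      using \<open>w \<in> ext_domain d\<close> that by (force simp: ext_domain_def PiE_iff)
    then have "0 \<le> (\<Prod>j<d. snd w j - fst w j)" "(\<Prod>j<d. snd w j - fst w j) \<le> 1"
      by (auto intro!: prod_nonneg prod_le_1)
    ultimately show "?h w \<le> ?K" by linarith
  qed (use p in auto)
  then have "(\<integral>\<^sup>+ w. ennreal (?g w) \<partial>?M) \<le> (\<integral>\<^sup>+ w. ennreal (?K powr p) * indicator (ext_domain d) w \<partial>?M)"
    by (intro nn_integral_mono) (auto split: split_indicator intro!: ennreal_leI)
  also have "\<dots> = ennreal (?K powr p) * emeasure ?M (ext_domain d)"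
    by (simp add: nn_integral_cmult_indicator)
  also have "\<dots> < top"
  proof -
    have "emeasure ?M (ext_domain d) \<le> (\<integral>\<^sup>+ w. (\<Prod>j<d. indicator ({0..1::real} \<times> {0..1::real}) (fst w j, snd w j)) \<partial>?M)"
      unfolding nn_integral_indicator[OF ext_domain_measurable, symmetric]
      by (intro nn_integral_mono) (auto simp: ext_domain_def PiE_iff split: split_indicator)
    also have "\<dots> = 1"
      by (subst nn_integral_lborel_dim_pair_prod) (auto simp: lborel.emeasure_pair_measure_Times)
    finally show ?thesis
      by (simp add: ennreal_mult_less_top order_le_less_trans)
  qed
  finally have "(\<integral>\<^sup>+ w. ennreal (?g w) \<partial>?M) < top" .
  moreover have "integral\<^sup>L ?M ?g = enn2real (\<integral>\<^sup>+ w. ennreal (?g w) \<partial>?M)"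
    by (intro integral_eq_nn_integral) auto
  ultimately have "ennreal (integral\<^sup>L ?M ?g) = (\<integral>\<^sup>+ w. ennreal (?g w) \<partial>?M)"
    by simp
  moreover have "ext_discrepancy p d P c powr p = integral\<^sup>L ?M ?g"
  proof -
    have "ext_discrepancy p d P c = integral\<^sup>L ?M ?g powr (1 / p)"
      unfolding ext_discrepancy_def set_lebesgue_integral_def
      by (simp add: case_prod_unfold mult.commute)
    moreover have "0 \<le> integral\<^sup>L ?M ?g" by simp
    ultimately show ?thesis using p by (simp add: powr_powr)
  qed
  ultimately show ?thesis
    by (simp add: ennreal_mult ennreal_indicator)
qed

text \<open>
  Boxes avoiding \<open>P\<close> contribute the same to both discrepancies, and the remaining boxes are covered by
  \<open>card P\<close> families, each carrying at most the fraction \<open>(1 - escape_mass p)\<^sup>d\<close> of the initial moment.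
\<close>

lemma ext_discrepancy_lower_bound:
  assumes p: "0 < p" and fin: "finite P" and P: "P \<subseteq> extensional {..<d}"
  shows "(1 - real (card P) * (1 - escape_mass p) ^ d) * ext_initial_discrepancy p d powr p
    \<le> ext_discrepancy p d P c powr p"
proof -
  let ?M = "lborel_dim d \<Otimes>\<^sub>M lborel_dim d"
  let ?V = "\<lambda>w. \<Prod>j<d. snd w j - fst w j"
  let ?h = "\<lambda>w. \<bar>(\<Sum>x\<in>P. c x * indicator (half_open_box d (fst w) (snd w)) x) - ?V w\<bar>"
  let ?B = "\<lambda>x. {w. x \<in> half_open_box d (fst w) (snd w)}"
  let ?r = "(1 - escape_mass p) ^ d"
  let ?I = "ext_initial_discrepancy p d powr p"
  have r: "0 \<le> ?r" using escape_mass_bounds[of p] p by simp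
  have mB: "(\<lambda>w. ennreal (?V w powr p) * indicator (ext_domain d \<inter> ?B x) w) \<in> borel_measurable ?M"
    if "x \<in> P" for x
  proof -
    have "(\<lambda>w. ennreal (?V w powr p * indicator (ext_domain d) w *
        indicator (half_open_box d (fst w) (snd w)) x)) \<in> borel_measurable ?M"
      using boxes_containing_measurable[of x d] P that by (measurable; auto)
    also have "(\<lambda>w. ennreal (?V w powr p * indicator (ext_domain d) w *
        indicator (half_open_box d (fst w) (snd w)) x)) =
        (\<lambda>w. ennreal (?V w powr p) * indicator (ext_domain d \<inter> ?B x) w)"
      by (auto split: split_indicator)
    finally show ?thesis .
  qed
  have mh: "(\<lambda>w. ennreal (?h w powr p) * indicator (ext_domain d) w) \<in> borel_measurable ?M"
    using boxes_containing_measurable P fin by (measurable; auto)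
  have pointwise: "ennreal (?V w powr p) * indicator (ext_domain d) w \<le>
      ennreal (?h w powr p) * indicator (ext_domain d) w +
      (\<Sum>x\<in>P. ennreal (?V w powr p) * indicator (ext_domain d \<inter> ?B x) w)" for w
  proof (cases "w \<in> ext_domain d \<and> (\<exists>x\<in>P. w \<in> ?B x)")
    case True
    then obtain x where x: "x \<in> P" "w \<in> ext_domain d \<inter> ?B x" by auto
    have "ennreal (?V w powr p) * indicator (ext_domain d) w =
        ennreal (?V w powr p) * indicator (ext_domain d \<inter> ?B x) w"
      using x by simp
    also have "\<dots> \<le> (\<Sum>x\<in>P. ennreal (?V w powr p) * indicator (ext_domain d \<inter> ?B x) w)"
      using x fin by (intro member_le_sum) auto
    finally show ?thesis by (simp add: add_increasing)
  next
    case False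
    then consider "w \<notin> ext_domain d" | "w \<in> ext_domain d" "\<forall>x\<in>P. x \<notin> half_open_box d (fst w) (snd w)"
      by auto
    then show ?thesis
    proof cases
      case 2
      then have "0 \<le> ?V w" by (auto simp: ext_domain_def intro!: prod_nonneg)
      with 2 have "?h w = ?V w" by simp
      then show ?thesis by (simp add: add_increasing2)
    qed simp
  qed
  have "ennreal ?I = (\<integral>\<^sup>+ w. ennreal (?V w powr p) * indicator (ext_domain d) w \<partial>?M)"
    using ext_initial_discrepancy_powr(1)[OF p] nn_integral_initial by simp
  also have "\<dots> \<le> (\<integral>\<^sup>+ w. ennreal (?h w powr p) * indicator (ext_domain d) w +
      (\<Sum>x\<in>P. ennreal (?V w powr p) * indicator (ext_domain d \<inter> ?B x) w) \<partial>?M)"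
    by (intro nn_integral_mono pointwise)
  also have "\<dots> = ennreal (ext_discrepancy p d P c powr p) +
      (\<Sum>x\<in>P. \<integral>\<^sup>+ w. ennreal (?V w powr p) * indicator (ext_domain d \<inter> ?B x) w \<partial>?M)"
    using mB mh by (simp add: nn_integral_add nn_integral_sum ext_discrepancy_powr[OF assms])
  also have "\<dots> \<le> ennreal (ext_discrepancy p d P c powr p) + (\<Sum>x\<in>P. ennreal ?r * ennreal ?I)"
    unfolding ext_initial_discrepancy_powr(1)[OF p]
    using p P by (intro add_left_mono sum_mono nn_integral_boxes_containing_le) auto
  also have "\<dots> = ennreal (ext_discrepancy p d P c powr p + real (card P) * (?r * ?I))"
    using r by (simp add: ennreal_mult ennreal_plus ennreal_of_nat_eq_real_of_nat)
  finally have "?I \<le> ext_discrepancy p d P c powr p + real (card P) * (?r * ?I)"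
    using r by (subst (asm) ennreal_le_iff) auto
  then show ?thesis by (simp add: algebra_simps)
qed

text \<open>
  Points on the diagonal suffice. Nonemptiness matters because \<open>Inf {}\<close> is an unspecified real number,
  for which no lower bound could be inferred.
\<close>

lemma point_sets_nonempty:
  assumes "1 \<le> d" shows "point_sets N d \<noteq> {}"
proof -
  let ?e = "\<lambda>t::real. restrict (\<lambda>_. t) {..<d}"
  have "inj ?e"
    using assms by (intro injI) (auto dest!: fun_cong[of _ _ 0])
  then have "inj_on ?e {0..<1}" by (rule inj_on_subset) simp
  then have "infinite (?e ` {0..<1})" by (simp add: finite_image_iff)
  then obtain P where "finite P" "card P = N" "P \<subseteq> ?e ` {0..<1}"
    using infinite_arbitrarily_large by blast
  moreover have "?e ` {0..<1} \<subseteq> {..<d} \<rightarrow>\<^sub>E {0..<1}" by (auto simp: PiE_iff split: if_splits)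
  ultimately have "P \<in> point_sets N d" by (simp add: point_sets_def)
  then show ?thesis by blast
qed

text \<open>
  Any class of weighted \<open>N\<close>-point sets will do for \<open>X\<close>, so that this covers the infimum over nonnegative
  weights and that over equal weights together.
\<close>

lemma Inf_ext_discrepancy_bound:
  assumes p: "1 \<le> p" and \<epsilon>: "0 \<le> \<epsilon>" "\<epsilon> < 1"
    and X: "X \<noteq> {}" "\<And>v. v \<in> X \<Longrightarrow> \<exists>P\<in>point_sets N d. \<exists>c. v = ext_discrepancy p d P c"
    and le: "Inf X \<le> \<epsilon> * ext_initial_discrepancy p d"
  shows "1 - \<epsilon> \<le> real N * (1 - escape_mass p) ^ d"
proof (cases "1 - real N * (1 - escape_mass p) ^ d \<le> 0")
  case True
  then show ?thesis using \<epsilon> by linarith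
next
  case False
  let ?m = "1 - real N * (1 - escape_mass p) ^ d" and ?I = "ext_initial_discrepancy p d"
  have I: "0 < ?I" using ext_initial_discrepancy_powr(2) p by simp
  have "?m powr (1/p) * ?I \<le> v" if "v \<in> X" for v
  proof -
    obtain P c where P: "P \<in> point_sets N d" "v = ext_discrepancy p d P c"
      using X(2) \<open>v \<in> X\<close> by blast
    then have v: "0 \<le> v" by (simp add: ext_discrepancy_def)
    have "?m * ?I powr p \<le> v powr p"
      using ext_discrepancy_lower_bound[of p P d c] P p
      by (auto simp: point_sets_def PiE_def)
    then have "(?m powr (1/p) * ?I) powr p \<le> v powr p"
      using False I p by (simp add: powr_mult powr_powr)
    then show ?thesis
      using v p powr_less_mono2[of p v "?m powr (1/p) * ?I"] by (meson not_less order_less_le_trans zero_less_one)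
  qed
  then have "?m powr (1/p) * ?I \<le> \<epsilon> * ?I"
    using X(1) le by (meson cInf_greatest order_trans)
  then have "?m powr (1/p) \<le> \<epsilon>" using I by simp
  then have "(?m powr (1/p)) powr p \<le> \<epsilon> powr p"
    using p by (intro powr_mono2) auto
  then have "?m \<le> \<epsilon> powr p" using False p by (simp add: powr_powr)
  also have "\<dots> \<le> \<epsilon> powr 1" using \<epsilon> p by (intro powr_mono') auto
  finally show ?thesis using \<epsilon> by simp
qed

lemma ereal_le_Inf_enat:
  assumes "\<And>N. N \<in> S \<Longrightarrow> r \<le> real N"
  shows "ereal r \<le> ereal_of_enat (Inf (enat ` S))"
proof (cases "S = {}")
  case True
  then show ?thesis by (simp add: top_enat_def)
next
  case False
  then have "Inf (enat ` S) \<in> enat ` S"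
    by (auto intro: wellorder_InfI)
  then show ?thesis using assms by auto
qed

theorem theorem4:
  fixes p :: real
  assumes "1 < p"
  shows "\<exists>C::real. 1 < C \<and>
    (\<forall>d::nat. \<forall>\<epsilon>::real. 1 \<le> d \<longrightarrow> 0 \<le> \<epsilon> \<longrightarrow> \<epsilon> < 1 / 2 \<longrightarrow>
       ereal_of_enat (N_disc_plus p \<epsilon> d) \<ge> ereal (C ^ d * (1 - 2 * \<epsilon>)) \<and>
       ereal_of_enat (N_disc_QMC p \<epsilon> d) \<ge> ereal (C ^ d * (1 - 2 * \<epsilon>)))"
proof (intro exI conjI allI impI)
  let ?r = "1 - escape_mass p"
  have r: "0 < ?r" "?r < 1" using escape_mass_bounds[of p] assms by auto
  show "1 < 1 / ?r" using r by simp
  fix d :: nat and \<epsilon> :: real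
  assume d: "1 \<le> d" and \<epsilon>: "0 \<le> \<epsilon>" "\<epsilon> < 1 / 2"
  have count: "(1 / ?r) ^ d * (1 - 2 * \<epsilon>) \<le> real N"
    if "X \<noteq> {}" "\<And>v. v \<in> X \<Longrightarrow> \<exists>P\<in>point_sets N d. \<exists>c. v = ext_discrepancy p d P c"
      "Inf X \<le> \<epsilon> * ext_initial_discrepancy p d" for N X
  proof -
    have "1 - \<epsilon> \<le> real N * ?r ^ d"
      using Inf_ext_discrepancy_bound[OF _ _ _ that] assms \<epsilon> by simp
    then have "1 - 2 * \<epsilon> \<le> real N * ?r ^ d" using \<epsilon> by linarith
    then show ?thesis using r by (simp add: power_divide pos_divide_le_eq)
  qed
  show "ereal ((1 / ?r) ^ d * (1 - 2 * \<epsilon>)) \<le> ereal_of_enat (N_disc_plus p \<epsilon> d)"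
    unfolding N_disc_plus_def
  proof (rule ereal_le_Inf_enat)
    fix N assume "N \<in> {N. 1 \<le> N \<and> disc_ext_plus p N d \<le> \<epsilon> * ext_initial_discrepancy p d}"
    moreover have "{ext_discrepancy p d P c | P c. P \<in> point_sets N d \<and> (\<forall>x\<in>P. 0 \<le> c x)} \<noteq> {}"
      using point_sets_nonempty[OF d, of N] by (auto intro!: exI[of _ "\<lambda>_. 0"])
    ultimately show "(1 / ?r) ^ d * (1 - 2 * \<epsilon>) \<le> real N"
      unfolding disc_ext_plus_def mem_Collect_eq by (elim conjE, intro count) blast+
  qed
  show "ereal ((1 / ?r) ^ d * (1 - 2 * \<epsilon>)) \<le> ereal_of_enat (N_disc_QMC p \<epsilon> d)"
    unfolding N_disc_QMC_def
  proof (rule ereal_le_Inf_enat)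
    fix N assume "N \<in> {N. 1 \<le> N \<and> disc_ext_QMC p N d \<le> \<epsilon> * ext_initial_discrepancy p d}"
    moreover have "{ext_discrepancy p d P (\<lambda>_. 1 / real N) | P. P \<in> point_sets N d} \<noteq> {}"
      using point_sets_nonempty[OF d, of N] by auto
    ultimately show "(1 / ?r) ^ d * (1 - 2 * \<epsilon>) \<le> real N"
      unfolding disc_ext_QMC_def mem_Collect_eq by (elim conjE, intro count) blast+
  qed
qed

end
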